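(* If $p\in(0,1)$ is constant, $q=1-p$ and $\gamma=1/(pq)$, then for any $\omega=\omega(n)\gg1$, as $n\to\infty$, $$\mathbb{P}\big[\mathbf{C}_{n,p}\text{ contains a run of }k\text{ equal nonzero terms}\big]\to\begin{cases}0,&\text{if } k=\log_\gamma n+\omega,\\ 1,&\text{if } k=\log_\gamma n-\omega.\end{cases}$$
   Context: An $n$-composition is a sequence of $n$ nonnegative integers. For $p\in[0,1)$ and $q=1-p$, the geometric random composition $\mathbf{C}_{n,p}$ is the random $n$-composition whose terms are independent, with $\mathbb{P}[\mathbf{C}_{n,p}(i)=j]=qp^j$ for every $j\ge0$ and $i\in\{1,\dots,n\}$. A composition contains a run of $k$ equal nonzero terms if there are $k$ consecutive terms all equal to the same positive integer (the run need not be maximal). Here $k=k(n)$ is a positive integer. $\omega\gg1$ means $\omega(n)\to\infty$ as $n\to\infty$. *)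

theory Defs
  imports "HOL-Probability.Probability"
begin

text \<open>
  An \<open>n\<close>-composition is a function on the positions \<open>{1..n}\<close>, extended by \<open>0\<close> outside
  this set.  The parameter of \<open>geometric_pmf\<close> is the success probability \<open>q = 1 - p\<close>, so that the
  probability of the value \<open>j\<close> is \<open>q * p ^ j\<close>; the lemmas below record the distribution of the
  terms and their independence.
\<close>

definition geom_composition :: "nat \<Rightarrow> real \<Rightarrow> (nat \<Rightarrow> nat) pmf" where
  "geom_composition n p = Pi_pmf {1..n} 0 (\<lambda>_. geometric_pmf (1 - p))"

text \<open>
  Positions \<open>i, \<dots>, i + k - 1\<close> have to lie in \<open>{1..n}\<close>.  The run need not be maximal.
\<close>

definition contains_nonzero_run :: "nat \<Rightarrow> nat \<Rightarrow> (nat \<Rightarrow> nat) \<Rightarrow> bool" where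
  "contains_nonzero_run n k c \<longleftrightarrow>
     (\<exists>i\<ge>1. i + k \<le> n + 1 \<and> (\<exists>j>0. \<forall>l<k. c (i + l) = j))"

lemma prob_geom_composition_component:
  assumes "0 \<le> p" "p < 1" "i \<in> {1..n}"
  shows "measure_pmf.prob (geom_composition n p) {c. c i = j} = (1 - p) * p ^ j"
proof -
  have "measure_pmf.prob (geom_composition n p) {c. c i = j}
      = pmf (map_pmf (\<lambda>c. c i) (geom_composition n p)) j"
    by (simp add: pmf_map vimage_def)
  also have "map_pmf (\<lambda>c. c i) (geom_composition n p) = geometric_pmf (1 - p)"
    using assms by (simp add: geom_composition_def Pi_pmf_component)
  finally show ?thesis
    using assms by simp
qed

lemma indep_vars_geom_composition:
  "prob_space.indep_vars (geom_composition n p) (\<lambda>_. count_space UNIV) (\<lambda>i c. c i) {1..n}"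
  unfolding geom_composition_def by (rule indep_vars_Pi_pmf) auto

end

theory Submission
  imports Defs
begin

text \<open>
  Put \<open>r = p * q = 1 / \<gamma>\<close>, the probability that a given term equals \<open>1\<close>.  The runs of ones already
  decide the question: a run of \<open>k\<close> terms equal to \<open>j\<close> has probability
  \<open>(q * p ^ j) ^ k = r ^ k * p ^ ((j - 1) * k)\<close>, so summing over all values \<open>j > 0\<close> costs only a
  constant factor.

  \<^item> Upper bound (\<open>prob_contains_nonzero_run_le\<close>): by the union bound over the starting position and
  the value, a run has probability at most \<open>n * r ^ k / q\<close>, which is \<open>\<gamma> powr (- \<omega>) / q\<close> if
  \<open>k = log \<gamma> n + \<omega>\<close>.

  \<^item> Lower bound (\<open>prob_run_free_le\<close>): cutting \<open>{1..n}\<close> into disjoint blocks of length \<open>k\<close> would lose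
  a factor \<open>k\<close>, which is too much when \<open>\<omega>\<close> grows slowly, and the overlapping windows are not
  independent.  Both problems disappear when one looks at the position \<open>m\<close> at which the first run of
  ones is completed.  That happens at \<open>m\<close> as soon as the term \<open>m - k\<close> is not \<open>1\<close>, the next \<open>k\<close> terms
  are all \<open>1\<close>, and no run occurs before position \<open>m - k\<close>.  These events concern disjoint sets of
  positions, so if \<open>a m\<close> is the probability that the first \<open>m\<close> terms contain no run, then
  \<open>a m \<le> a (m - 1) - a (m - k - 1) * (1 - r) * r ^ k \<le> a (m - 1) * (1 - (1 - r) * r ^ k)\<close>
  for \<open>m > k\<close>.
  Hence \<open>a n \<le> exp (- (n - k) * (1 - r) * r ^ k)\<close>.  If \<open>k = log \<gamma> n - \<omega>\<close>, then
  \<open>r ^ k = \<gamma> powr \<omega> / n\<close> and \<open>k\<close> is at most \<open>n / 2\<close> eventually, so the exponent tends to \<open>- \<infinity>\<close>.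
\<close>

section \<open>Events on disjoint sets of coordinates\<close>

text \<open>
  Events are not countable sets in general, but only their parts inside the countable supports
  matter.
\<close>

lemma prob_pair_pmf_Times:
  "measure_pmf.prob (pair_pmf M N) (A \<times> B) = measure_pmf.prob M A * measure_pmf.prob N B"
proof -
  have "measure_pmf.prob (pair_pmf M N) (A \<times> B)
      = measure_pmf.prob (pair_pmf M N) ((A \<inter> set_pmf M) \<times> (B \<inter> set_pmf N))"
    by (subst measure_Int_set_pmf[symmetric]) (auto intro!: arg_cong[where f = "measure _"])
  also have "\<dots> = measure_pmf.prob M (A \<inter> set_pmf M) * measure_pmf.prob N (B \<inter> set_pmf N)"
    by (intro measure_pmf_prob_product) (auto intro: countable_Int2)
  finally show ?thesis by (simp add: measure_Int_set_pmf)
qed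

text \<open>
  Independence in the form in which the recursion for run-free sequences uses it: splitting the
  product measure into the coordinates outside and inside \<open>C\<close> turns the event into a rectangle.
\<close>

lemma prob_Pi_pmf_Int_cylinder:
  assumes A: "finite A" "C \<subseteq> A"
    and E: "\<And>f g. (\<And>x. x \<in> A - C \<Longrightarrow> f x = g x) \<Longrightarrow> f \<in> E \<longleftrightarrow> g \<in> E"
  shows "measure_pmf.prob (Pi_pmf A d D) (E \<inter> Pi C S)
       = measure_pmf.prob (Pi_pmf A d D) E * (\<Prod>x\<in>C. measure_pmf.prob (D x) (S x))"
proof -
  let ?B = "A - C"
  let ?h = "\<lambda>(f, g) x. if x \<in> ?B then f x else g x"
  let ?Q = "pair_pmf (Pi_pmf ?B d D) (Pi_pmf C d D)"
  have fin: "finite C" "finite ?B" using A finite_subset by auto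
  have union: "Pi_pmf A d D = map_pmf ?h ?Q"
    using Pi_pmf_union[of ?B C d D, OF fin(2,1)] A by (simp add: Un_absorb2 inf_commute[of "A - C"])
  have E_iff: "?h (f, g) \<in> E \<longleftrightarrow> f \<in> E" for f g
    by (rule E) simp
  have Pi_iff: "?h (f, g) \<in> Pi C S \<longleftrightarrow> g \<in> Pi C S" for f g
    by (auto simp: Pi_def)
  have preim: "?h -` (E \<inter> Pi C S) = E \<times> Pi C S" "?h -` E = E \<times> UNIV"
    using E_iff Pi_iff by auto
  have "measure_pmf.prob (Pi_pmf A d D) (E \<inter> Pi C S)
      = measure_pmf.prob (Pi_pmf ?B d D) E * measure_pmf.prob (Pi_pmf C d D) (Pi C S)"
    unfolding union measure_map_pmf preim prob_pair_pmf_Times ..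
  moreover have "measure_pmf.prob (Pi_pmf A d D) E = measure_pmf.prob (Pi_pmf ?B d D) E"
    unfolding union measure_map_pmf preim prob_pair_pmf_Times by simp
  ultimately show ?thesis
    using fin by (simp add: measure_Pi_pmf_Pi)
qed

section \<open>The union bound\<close>

text \<open>
  The sum over the values \<open>j > 0\<close> converges like a geometric series, uniformly in \<open>k\<close>, because
  \<open>p ^ k \<le> p\<close>.
\<close>

lemma prob_contains_nonzero_run_le:
  assumes p: "0 < p" "p < 1" and k: "0 < k"
  shows "measure_pmf.prob (geom_composition n p) {c. contains_nonzero_run n k c}
       \<le> real n * (p * (1 - p)) ^ k / (1 - p)"
proof -
  let ?M = "geom_composition n p"
  let ?r = "p * (1 - p)"
  define I where "I = {i. 1 \<le> i \<and> i + k \<le> n + 1}"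
  define E where "E = (\<lambda>i j. {c. \<forall>l<k. c (i + l) = Suc j} :: (nat \<Rightarrow> nat) set)"
  have I: "I \<subseteq> {1..n}" using k by (auto simp: I_def)
  then have finI: "finite I" using finite_subset by blast
  have E_le: "measure_pmf.prob ?M (E i j) \<le> ?r ^ k * p ^ j" if "i \<in> I" for i j
  proof -
    have eq: "E i j = UNIV \<inter> Pi {i..<i + k} (\<lambda>_. {Suc j})"
    proof -
      have "(\<forall>l<k. c (i + l) = Suc j) \<longleftrightarrow> (\<forall>x\<in>{i..<i + k}. c x = Suc j)" for c :: "nat \<Rightarrow> nat"
        by (metis add.commute add_less_cancel_left atLeastLessThan_iff le_add1 le_iff_add)
      then show ?thesis by (auto simp: E_def Pi_def)
    qed
    have "measure_pmf.prob ?M (E i j) = ((1 - p) * p ^ Suc j) ^ k"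
      unfolding eq geom_composition_def using that k p
      by (subst prob_Pi_pmf_Int_cylinder) (auto simp: I_def measure_pmf_single mult.commute)
    also have "\<dots> = ?r ^ k * (p ^ j) ^ k"
      by (simp add: power_mult_distrib mult_ac)
    also have "\<dots> \<le> ?r ^ k * (p ^ j) ^ 1"
      using p k by (intro mult_left_mono power_decreasing) (auto simp: power_le_one)
    finally show ?thesis by simp
  qed
  have geometric: "(\<lambda>j. ?r ^ k * p ^ j) sums (?r ^ k * (1 / (1 - p)))"
    using p by (intro sums_mult geometric_sums) auto
  have start_le: "measure_pmf.prob ?M (\<Union>j. E i j) \<le> ?r ^ k / (1 - p)" if "i \<in> I" for i
  proof -
    have summ: "summable (\<lambda>j. measure_pmf.prob ?M (E i j))"
      by (rule summable_comparison_test'[OF sums_summable[OF geometric], of 0])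
         (simp add: E_le that)
    have "measure_pmf.prob ?M (\<Union>j. E i j) \<le> (\<Sum>j. measure_pmf.prob ?M (E i j))"
      using summ by (intro measure_pmf.finite_measure_subadditive_countably) simp_all
    also have "\<dots> \<le> (\<Sum>j. ?r ^ k * p ^ j)"
      by (intro suminf_le E_le that summ sums_summable[OF geometric])
    also have "\<dots> = ?r ^ k / (1 - p)"
      using sums_unique[OF geometric] by simp
    finally show ?thesis .
  qed
  have "{c. contains_nonzero_run n k c} \<subseteq> (\<Union>i\<in>I. \<Union>j. E i j)"
  proof
    fix c assume "c \<in> {c. contains_nonzero_run n k c}"
    then obtain i j where "i \<in> I" "j > 0" "\<forall>l<k. c (i + l) = j"
      by (auto simp: contains_nonzero_run_def I_def)
    then have "i \<in> I" "c \<in> E i (j - 1)" by (auto simp: E_def)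
    then show "c \<in> (\<Union>i\<in>I. \<Union>j. E i j)" by blast
  qed
  then have "measure_pmf.prob ?M {c. contains_nonzero_run n k c}
      \<le> measure_pmf.prob ?M (\<Union>i\<in>I. \<Union>j. E i j)"
    by (intro measure_pmf.finite_measure_mono) auto
  also have "\<dots> \<le> (\<Sum>i\<in>I. measure_pmf.prob ?M (\<Union>j. E i j))"
    using finI by (intro measure_pmf.finite_measure_subadditive_finite) auto
  also have "\<dots> \<le> (\<Sum>i\<in>I. ?r ^ k / (1 - p))"
    by (intro sum_mono start_le)
  also have "\<dots> \<le> real n * (?r ^ k / (1 - p))"
    using card_mono[OF _ I] p unfolding sum_constant by (intro mult_right_mono) auto
  finally show ?thesis by simp
qed

section \<open>Avoiding runs of a fixed value\<close>

definition run_free :: "nat \<Rightarrow> 'a \<Rightarrow> nat \<Rightarrow> (nat \<Rightarrow> 'a) \<Rightarrow> bool" where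
  "run_free k v m c \<longleftrightarrow> (\<forall>i\<ge>1. i + k \<le> m + 1 \<longrightarrow> (\<exists>l<k. c (i + l) \<noteq> v))"

lemma run_free_mono: "run_free k v m c \<Longrightarrow> m' \<le> m \<Longrightarrow> run_free k v m' c"
  by (auto simp: run_free_def)

lemma run_free_cong:
  assumes "\<And>x. x \<in> {1..m} \<Longrightarrow> c x = c' x"
  shows "run_free k v m c \<longleftrightarrow> run_free k v m c'"
proof -
  have "c (i + l) = c' (i + l)" if "i \<ge> 1" "i + k \<le> m + 1" "l < k" for i l
    using that by (intro assms) auto
  then show ?thesis unfolding run_free_def by metis
qed

text \<open>
  A term different from \<open>v\<close> blocks every run that would cross it.  A run that ends at most at
  \<open>j + k\<close> and does not cross position \<open>j + 1\<close> must lie within the first \<open>j\<close> positions, as only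
  \<open>k - 1\<close> positions remain on the right of \<open>j + 1\<close>.
\<close>

lemma run_free_extend:
  assumes "run_free k v j c" "c (Suc j) \<noteq> v"
  shows "run_free k v (j + k) c"
  unfolding run_free_def
proof (intro allI impI)
  fix i assume i: "1 \<le> i" "i + k \<le> j + k + 1"
  show "\<exists>l<k. c (i + l) \<noteq> v"
  proof (cases "i + k \<le> j + 1")
    case True
    then show ?thesis using assms(1) i by (auto simp: run_free_def)
  next
    case False
    then show ?thesis using assms(2) i by (intro exI[of _ "Suc j - i"]) auto
  qed
qed

text \<open>
  Among the sequences without a run up to position \<open>j + k\<close>, those whose last \<open>k + 1\<close> terms up to
  position \<open>j + k + 1\<close> are a term different from \<open>v\<close> followed by \<open>k\<close> copies of \<open>v\<close> are lost in the
  next step.  By independence they have probability \<open>a j * (1 - r) * r ^ k\<close>, where \<open>a\<close> denotes the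
  probability of having no run yet.  Since \<open>a\<close> is decreasing, \<open>a j\<close> may be replaced by the smaller
  \<open>a (j + k)\<close>, so that every step past \<open>k\<close> gains a constant factor.
\<close>

lemma prob_run_free_le:
  fixes D :: "'a pmf" and v :: 'a
  assumes k: "0 < k"
  defines "r \<equiv> pmf D v"
  shows "measure_pmf.prob (Pi_pmf {1..n} d (\<lambda>_. D)) {c. run_free k v n c}
       \<le> (1 - (1 - r) * r ^ k) ^ (n - k)"
proof -
  let ?M = "Pi_pmf {1..n} d (\<lambda>_. D)"
  let ?a = "\<lambda>m. measure_pmf.prob ?M {c. run_free k v m c}"
  let ?x = "(1 - r) * r ^ k"
  have r: "0 \<le> r" "r \<le> 1" by (auto simp: r_def pmf_le_1)
  have x: "0 \<le> ?x" "?x \<le> 1" using r by (auto intro!: mult_le_one simp: power_le_one)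
  have step: "?a (Suc (j + k)) \<le> ?a (j + k) * (1 - ?x)" if "Suc (j + k) \<le> n" for j
  proof -
    let ?C = "{Suc j..Suc (j + k)}"
    let ?S = "\<lambda>x. if x = Suc j then - {v} else {v}"
    let ?E = "{c. run_free k v j c} \<inter> Pi ?C ?S"
    have split: "?C = insert (Suc j) {Suc (Suc j)..Suc (j + k)}" by auto
    have "measure_pmf.prob D (- {v}) = 1 - r"
      using measure_pmf.prob_compl[of "{v}" D]
      by (simp add: r_def measure_pmf_single Compl_eq_Diff_UNIV[symmetric])
    then have "(\<Prod>x\<in>?C. measure_pmf.prob D (?S x)) = ?x"
      unfolding split by (subst prod.insert) (auto simp: r_def measure_pmf_single)
    moreover have "measure_pmf.prob ?M ?E
        = ?a j * (\<Prod>x\<in>?C. measure_pmf.prob D (?S x))"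
    proof (rule prob_Pi_pmf_Int_cylinder)
      fix f g :: "nat \<Rightarrow> 'a"
      assume "\<And>x. x \<in> {1..n} - ?C \<Longrightarrow> f x = g x"
      then have "run_free k v j f \<longleftrightarrow> run_free k v j g"
        using that by (intro run_free_cong) auto
      then show "f \<in> {c. run_free k v j c} \<longleftrightarrow> g \<in> {c. run_free k v j c}" by simp
    qed (use that in auto)
    ultimately have E: "measure_pmf.prob ?M ?E = ?a j * ?x" by simp
    \<comment> \<open>\<open>?E\<close> is the event that is lost between the positions \<open>j + k\<close> and \<open>j + k + 1\<close>.\<close>
    have disj: "{c. run_free k v (Suc (j + k)) c} \<inter> ?E = {}"
    proof -
      have False if "run_free k v (Suc (j + k)) c" "c \<in> Pi ?C ?S" for c
      proof -
        have "\<exists>l<k. c (Suc (Suc j) + l) \<noteq> v"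
          by (rule that(1)[unfolded run_free_def, rule_format]) auto
        then obtain l where "l < k" "c (Suc (Suc j) + l) \<noteq> v" by blast
        moreover have "c (Suc (Suc j) + l) \<in> ?S (Suc (Suc j) + l)"
          using that(2) \<open>l < k\<close> by (rule_tac Pi_mem) auto
        ultimately show False by simp
      qed
      then show ?thesis by blast
    qed
    have sub: "{c. run_free k v (Suc (j + k)) c} \<union> ?E \<subseteq> {c. run_free k v (j + k) c}"
    proof -
      have "c (Suc j) \<noteq> v" if "c \<in> Pi ?C ?S" for c
        using Pi_mem[OF that, of "Suc j"] by simp
      then show ?thesis by (auto intro: run_free_extend run_free_mono)
    qed
    have "?a (Suc (j + k)) + ?a j * ?x
        = measure_pmf.prob ?M ({c. run_free k v (Suc (j + k)) c} \<union> ?E)"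
      using disj E by (subst measure_pmf.finite_measure_Union) auto
    also have "\<dots> \<le> ?a (j + k)"
      using sub by (intro measure_pmf.finite_measure_mono) auto
    finally have "?a (Suc (j + k)) + ?a j * ?x \<le> ?a (j + k)" .
    moreover have "?a (j + k) * ?x \<le> ?a j * ?x"
      using x by (intro mult_right_mono measure_pmf.finite_measure_mono) (auto intro: run_free_mono)
    ultimately show ?thesis by (simp add: algebra_simps)
  qed
  have bound: "?a (j + k) \<le> (1 - ?x) ^ j" if "j + k \<le> n" for j
    using that
  proof (induction j)
    case 0
    then show ?case by simp
  next
    case (Suc j)
    have "?a (Suc j + k) \<le> ?a (j + k) * (1 - ?x)" using step Suc.prems by simp
    also have "\<dots> \<le> (1 - ?x) ^ j * (1 - ?x)" using Suc x by (intro mult_right_mono) auto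
    finally show ?case by (simp add: mult.commute)
  qed
  show ?thesis
  proof (cases "k \<le> n")
    case True
    then show ?thesis using bound[of "n - k"] by simp
  qed simp
qed

lemma prob_contains_nonzero_run_ge:
  assumes p: "0 < p" "p < 1" and k: "0 < k"
  defines "r \<equiv> p * (1 - p)"
  shows "1 - exp (- (real (n - k) * ((1 - r) * r ^ k)))
       \<le> measure_pmf.prob (geom_composition n p) {c. contains_nonzero_run n k c}"
proof -
  let ?M = "geom_composition n p"
  let ?x = "(1 - r) * r ^ k"
  have r_pmf: "pmf (geometric_pmf (1 - p)) 1 = r"
    using p by (simp add: r_def)
  have "0 \<le> r" "r \<le> 1" unfolding r_pmf[symmetric] by (auto simp: pmf_le_1)
  then have x: "?x \<le> 1" by (auto intro!: mult_le_one simp: power_le_one)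
  have "measure_pmf.prob ?M {c. run_free k 1 n c} \<le> (1 - ?x) ^ (n - k)"
    using prob_run_free_le[OF k, of n 0 "geometric_pmf (1 - p)" 1]
    unfolding geom_composition_def r_pmf .
  also have "\<dots> \<le> exp (- ?x) ^ (n - k)"
    using x exp_ge_add_one_self[of "- ?x"] by (intro power_mono) auto
  also have "\<dots> = exp (- (real (n - k) * ?x))"
    by (simp add: exp_of_nat_mult[symmetric])
  finally have "measure_pmf.prob ?M {c. run_free k 1 n c} \<le> exp (- (real (n - k) * ?x))" .
  moreover have "1 - measure_pmf.prob ?M {c. run_free k 1 n c}
      = measure_pmf.prob ?M (- {c. run_free k 1 n c})"
    using measure_pmf.prob_compl[of "{c. run_free k 1 n c}" ?M]
    by (simp add: Compl_eq_Diff_UNIV[symmetric])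
  moreover have "contains_nonzero_run n k c" if "\<not> run_free k 1 n c" for c
    using that unfolding run_free_def contains_nonzero_run_def by (meson zero_less_one)
  then have "measure_pmf.prob ?M (- {c. run_free k 1 n c})
      \<le> measure_pmf.prob ?M {c. contains_nonzero_run n k c}"
    by (intro measure_pmf.finite_measure_mono) auto
  ultimately show ?thesis by linarith
qed

section \<open>The threshold\<close>

theorem proposition4p4:
  fixes p q \<gamma> :: real and \<omega> :: "nat \<Rightarrow> real" and k :: "nat \<Rightarrow> nat"
  assumes "0 < p" "p < 1" "q = 1 - p" "\<gamma> = 1 / (p * q)"
    and "filterlim \<omega> at_top sequentially"
    and "\<forall>\<^sub>F n in sequentially. k n > 0"
  shows "((\<forall>\<^sub>F n in sequentially. real (k n) = log \<gamma> (real n) + \<omega> n) \<longrightarrow>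
           (\<lambda>n. measure_pmf.prob (geom_composition n p) {c. contains_nonzero_run n (k n) c})
             \<longlonglongrightarrow> 0) \<and>
         ((\<forall>\<^sub>F n in sequentially. real (k n) = log \<gamma> (real n) - \<omega> n) \<longrightarrow>
           (\<lambda>n. measure_pmf.prob (geom_composition n p) {c. contains_nonzero_run n (k n) c})
             \<longlonglongrightarrow> 1)"
proof -
  let ?P = "\<lambda>n. measure_pmf.prob (geom_composition n p) {c. contains_nonzero_run n (k n) c}"
  define r where "r = p * (1 - p)"
  have p: "0 < p" "p < 1" using assms by auto
  have r0: "0 < r" using p by (simp add: r_def)
  have r1: "r < 1" unfolding r_def using p mult_strict_mono[of p 1 "1 - p" 1] by simp
  have \<gamma>: "\<gamma> = 1 / r" using assms by (simp add: r_def)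
  have \<gamma>1: "1 < \<gamma>" using r0 r1 by (simp add: \<gamma>)
  \<comment> \<open>Used with \<open>t = \<omega> n\<close> above the threshold and with \<open>t = - \<omega> n\<close> below it.\<close>
  have power_r: "r ^ m = \<gamma> powr (- t) / real n"
    if "real m = log \<gamma> (real n) + t" "0 < n" for m n t
  proof -
    have "r ^ m = \<gamma> powr (- real m)"
      using \<gamma>1 r0 by (simp add: \<gamma> powr_minus powr_realpow power_divide)
    also have "\<dots> = \<gamma> powr (- t) / \<gamma> powr (log \<gamma> (real n))"
      using that by (simp add: powr_diff[symmetric] algebra_simps)
    finally show ?thesis using \<gamma>1 that by simp
  qed
  have powr_top: "filterlim (\<lambda>n. \<gamma> powr \<omega> n) at_top sequentially"
  proof -
    have "filterlim (\<lambda>n. exp (\<omega> n * ln \<gamma>)) at_top sequentially"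
      using \<gamma>1 assms(5)
      by (intro filterlim_compose[OF exp_at_top] filterlim_at_top_mult_tendsto_pos[where c = "ln \<gamma>"]) auto
    then show ?thesis using \<gamma>1 by (simp add: powr_def)
  qed
  have "?P \<longlonglongrightarrow> 0" if ev: "\<forall>\<^sub>F n in sequentially. real (k n) = log \<gamma> (real n) + \<omega> n"
  proof (rule tendsto_sandwich[where f = "\<lambda>_. 0"])
    show "\<forall>\<^sub>F n in sequentially. ?P n \<le> inverse (\<gamma> powr \<omega> n) / (1 - p)"
      using ev assms(6) eventually_gt_at_top[of 0]
    proof eventually_elim
      case (elim n)
      show ?case
        using prob_contains_nonzero_run_le[OF p elim(2), of n] power_r[OF elim(1,3)] elim(3)
        by (simp add: r_def powr_minus)
    qed
    show "(\<lambda>n. inverse (\<gamma> powr \<omega> n) / (1 - p)) \<longlonglongrightarrow> 0"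
      using powr_top by (intro tendsto_divide_zero tendsto_inverse_0_at_top)
  qed auto
  moreover have "?P \<longlonglongrightarrow> 1" if ev: "\<forall>\<^sub>F n in sequentially. real (k n) = log \<gamma> (real n) - \<omega> n"
  proof (rule tendsto_sandwich[where h = "\<lambda>_. 1"])
    \<comment> \<open>The \<open>2\<close> comes from bounding \<open>n - k n\<close> below by \<open>n / 2\<close>.\<close>
    let ?f = "\<lambda>n. (1 - r) / 2 * \<gamma> powr \<omega> n"
    have "((\<lambda>x::real. ln x / x) \<longlongrightarrow> 0) at_top"
      using ln_x_over_x_tendsto_0 .
    then have "(\<lambda>n. ln (real n) / real n) \<longlonglongrightarrow> 0"
      by (rule filterlim_compose) (rule filterlim_real_sequentially)
    then have small: "\<forall>\<^sub>F n in sequentially. ln (real n) / real n < ln \<gamma> / 2"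
      using \<gamma>1 by (intro order_tendstoD(2)) auto
    have "\<forall>\<^sub>F n in sequentially. 0 \<le> \<omega> n"
      using assms(5) by (simp add: filterlim_at_top)
    with small show "\<forall>\<^sub>F n in sequentially. 1 - exp (- ?f n) \<le> ?P n"
      using ev assms(6) eventually_gt_at_top[of 0]
    proof eventually_elim
      case (elim n)
      have "log \<gamma> (real n) \<le> real n / 2"
        using elim(1,5) \<gamma>1 by (simp add: log_def field_simps)
      then have half: "real n / 2 \<le> real (n - k n)"
        using elim(2,3) by linarith
      have rk: "r ^ k n = \<gamma> powr \<omega> n / real n"
        using power_r[of "k n" n "- \<omega> n"] elim by simp
      have "?f n = real n / 2 * ((1 - r) * r ^ k n)"
        using elim(5) by (simp add: rk)
      also have "\<dots> \<le> real (n - k n) * ((1 - r) * r ^ k n)"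
        using half r0 r1 by (intro mult_right_mono) auto
      finally have "1 - exp (- ?f n) \<le> 1 - exp (- (real (n - k n) * ((1 - r) * r ^ k n)))"
        by simp
      also have "\<dots> \<le> ?P n"
        using prob_contains_nonzero_run_ge[OF p elim(4), of n] by (simp add: r_def)
      finally show ?case .
    qed
    have "filterlim ?f at_top sequentially"
      using r1 by (intro filterlim_tendsto_pos_mult_at_top[OF tendsto_const] powr_top) auto
    then have lim: "(\<lambda>n. exp (- ?f n)) \<longlonglongrightarrow> 0"
      by (intro filterlim_compose[OF exp_at_bot] filterlim_uminus_at_top[THEN iffD1])
    show "(\<lambda>n. 1 - exp (- ?f n)) \<longlonglongrightarrow> 1"
      using tendsto_diff[OF tendsto_const[of 1] lim] by simp
  qed auto
  ultimately show ?thesis by blast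
qed

end
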